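(* $$\frac{\sin(4\pi/13)}{\sin(2\pi/13)}-\frac{\sin(6\pi/13)}{\sin(3\pi/13)}-\frac{\sin(2\pi/13)}{\sin(\pi/13)}+\frac{\sin(5\pi/13)}{\sin(4\pi/13)}-\frac{\sin(3\pi/13)}{\sin(5\pi/13)}+\frac{\sin(\pi/13)}{\sin(6\pi/13)}=-1.$$ *)

theory Defs
  imports Complex_Main
begin

end

theory Submission
  imports Defs
begin

text \<open>
  Put \<open>x = pi / 13\<close>. Since \<open>sin (k * x) = sin ((13 - k) * x)\<close>, every quotient has the form
  \<open>sin (2 * k * x) / sin (k * x) = 2 * cos (k * x)\<close>. Multiplied by \<open>sin x\<close>, the resulting
  alternating sum of cosines telescopes to \<open>sin (7 * x) - sin (6 * x) - sin x = - sin x\<close>.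
\<close>

lemma sin_double_div_sin:
  fixes x :: real
  assumes "sin x \<noteq> 0"
  shows "sin (2 * x) / sin x = 2 * cos x"
  using assms by (simp add: sin_double)

text \<open>By product-to-sum, \<open>sin (j*x)\<close> arises from the cosines of index
  \<open>j - 1\<close> and \<open>j + 1\<close> with opposite signs. These two cosines have the same
  coefficient, so everything cancels for \<open>j\<close> from 2 to 5.\<close>

lemma alternating_cos_sum_times_sin:
  fixes x :: real
  shows "2 * (cos (2*x) - cos (3*x) - cos x + cos (4*x) - cos (5*x) + cos (6*x)) * sin x
         = sin (7*x) - sin (6*x) - sin x"
proof -
  have prod: "2 * cos (a*x) * sin x = sin ((a+1)*x) - sin ((a-1)*x)" for a :: real
    by (simp add: sin_add sin_diff algebra_simps)
  show ?thesis
    using prod[of 1] prod[of 2] prod[of 3] prod[of 4] prod[of 5] prod[of 6]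
    by (simp add: algebra_simps)
qed

theorem theorem4p4:
  "sin (4 * pi / 13) / sin (2 * pi / 13) - sin (6 * pi / 13) / sin (3 * pi / 13)
     - sin (2 * pi / 13) / sin (pi / 13) + sin (5 * pi / 13) / sin (4 * pi / 13)
     - sin (3 * pi / 13) / sin (5 * pi / 13) + sin (pi / 13) / sin (6 * pi / 13) = (-1 :: real)"
proof -
  define x :: real where "x = pi / 13"
  have pos: "sin (k * x) > 0" if "0 < k" "k < 13" for k :: real
    using that by (intro sin_gt_zero) (auto simp: x_def field_simps)
  have quot: "sin (2 * k * x) / sin (k * x) = 2 * cos (k * x)" if "0 < k" "k < 13" for k :: real
    using sin_double_div_sin[of "k * x"] pos[OF that] by (simp add: mult.assoc)
  have refl: "sin ((13 - k) * x) = sin (k * x)" for k :: real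
  proof -
    have "(13 - k) * x = pi - k * x"
      by (simp add: x_def field_simps)
    then show ?thesis
      by simp
  qed
  let ?C = "cos (2*x) - cos (3*x) - cos x + cos (4*x) - cos (5*x) + cos (6*x)"
  \<comment> \<open>Reflection gives \<open>sin (7*x) = sin (6*x)\<close>, leaving only
    \<open>- sin x\<close>.\<close>
  have "2 * ?C * sin x = - 1 * sin x"
    using alternating_cos_sum_times_sin[of x] refl[of 6] by simp
  then have "2 * ?C = - 1"
    using pos[of 1] by (subst (asm) mult_right_cancel) simp_all
  \<comment> \<open>The last three numerators become double angles by reflection: 5, 3, 1 turn into
    8, 10, 12, twice 4, 5, 6.\<close>
  moreover have
    "sin (4*x) / sin (2*x) - sin (6*x) / sin (3*x) - sin (2*x) / sin x
       + sin (5*x) / sin (4*x) - sin (3*x) / sin (5*x) + sin x / sin (6*x) = 2 * ?C"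
    using quot[of 1] quot[of 2] quot[of 3] quot[of 4] quot[of 5] quot[of 6]
      refl[of 5] refl[of 3] refl[of 1]
    by simp
  ultimately show ?thesis
    by (simp add: x_def)
qed

end
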